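(* Let $\sigma,n\ge2$ be integers with $\sigma\le n$. Any data structure supporting special rank queries for every string $T\in[0..\sigma)^n$ has worst-case space usage $\Omega(n\log\sigma)$ bits; that is, there is an absolute constant $\delta>0$ such that for all integers $2\le\sigma\le n$, any such data structure uses at least $\delta\, n\log\sigma$ bits on some string $T\in[0..\sigma)^n$.
   Context: Here $[0..\sigma)=\{0,\dots,\sigma-1\}$ and $\log$ is base 2. For a string $T$ of length $n$ and $j\in\{1,\dots,n\}$, the special rank query returns $\mathsf{special\text{-}rank}_T(j)=|\{i\in\{1,\dots,j\}:T[i]=T[j]\}|$. A data structure supporting a query problem for a family of inputs (with parameters $\sigma,n$ fixed) assigns to each input a finite bit string; the answer to every query on an input is determined by the stored bit string and the query arguments only. The space used on an input is the length of its bit string, and the worst-case space usage is the maximum over all inputs in the family. Query time is irrelevant. *)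

theory Defs
  imports Complex_Main
begin

definition strings :: "nat \<Rightarrow> nat \<Rightarrow> nat list set" where
  "strings \<sigma> n = {T. length T = n \<and> set T \<subseteq> {0..<\<sigma>}}"

text \<open>Positions are numbered from 1, whereas list indexing starts at 0; hence the shifts by 1.\<close>

definition special_rank :: "nat list \<Rightarrow> nat \<Rightarrow> nat" where
  "special_rank T j = card {i \<in> {1..j}. T ! (i - 1) = T ! (j - 1)}"

text \<open>
  A data structure for inputs in X and queries in Q consists of an encoder, which maps each input to
  its stored bit string, and a decoder, which answers a query from the stored bit string and the
  query arguments alone. Both are arbitrary functions, since query time is irrelevant; in particular
  they may depend on any parameters that determine X and Q.
\<close>

definition data_structure ::
    "'i set \<Rightarrow> 'q set \<Rightarrow> ('i \<Rightarrow> 'q \<Rightarrow> 'a) \<Rightarrow> ('i \<Rightarrow> bool list) \<Rightarrow> (bool list \<Rightarrow> 'q \<Rightarrow> 'a) \<Rightarrow> bool" where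
  "data_structure X Q answer enc dec \<longleftrightarrow> (\<forall>x\<in>X. \<forall>q\<in>Q. dec (enc x) q = answer x q)"

text \<open>Meaningful only for finite nonempty X.\<close>

definition worst_case_space :: "'i set \<Rightarrow> ('i \<Rightarrow> bool list) \<Rightarrow> nat" where
  "worst_case_space X enc = Max ((\<lambda>x. length (enc x)) ` X)"

lemma finite_strings: "finite (strings \<sigma> n)"
  using finite_lists_length_eq[of "{0..<\<sigma>}" n]
  by (simp add: strings_def conj_commute)

lemma strings_nonempty:
  assumes "0 < \<sigma>"
  shows "strings \<sigma> n \<noteq> {}"
proof -
  have "replicate n 0 \<in> strings \<sigma> n"
    using assms by (auto simp: strings_def)
  then show ?thesis by blast
qed

lemma le_worst_case_space_iff:
  fixes c :: real
  assumes "finite X" "X \<noteq> {}"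
  shows "c \<le> real (worst_case_space X enc) \<longleftrightarrow> (\<exists>x\<in>X. c \<le> real (length (enc x)))"
proof
  have "worst_case_space X enc \<in> (\<lambda>x. length (enc x)) ` X"
    unfolding worst_case_space_def using assms by (intro Max_in) auto
  then show "c \<le> real (worst_case_space X enc) \<Longrightarrow> \<exists>x\<in>X. c \<le> real (length (enc x))"
    by auto
next
  assume "\<exists>x\<in>X. c \<le> real (length (enc x))"
  then obtain x where x: "x \<in> X" "c \<le> real (length (enc x))" by blast
  have "length (enc x) \<le> worst_case_space X enc"
    unfolding worst_case_space_def using assms(1) x(1) by (intro Max_ge) auto
  with x(2) show "c \<le> real (worst_case_space X enc)" by linarith
qed

end

theory Submission
  imports Defs "HOL-Combinatorics.Multiset_Permutations" "HOL-Library.Discrete_Functions"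
begin

text \<open>
  Let the alphabet be \<open>{0..<s}\<close> with \<open>s\<^sup>2 \<le> n\<close>. Start with a prefix in which each symbol \<open>i\<close> occurs
  exactly \<open>i\<close> times, and continue with arbitrary permutations of the alphabet, one after the other.
  After \<open>k\<close> permutations the symbol \<open>i\<close> has occurred \<open>i + k\<close> times, so the special ranks in the next
  permutation are \<open>i + k + 1\<close> and reveal its symbols. The prefix takes at most half of the string,
  which leaves about \<open>n / (2 * s)\<close> permutations and thus information of the order of \<open>n * log s\<close> bits.
  Taking \<open>s\<close> to be about \<open>sqrt \<sigma>\<close> costs only a constant factor.
\<close>

text \<open>Equal bit strings are decoded to equal answers, so inputs that some query tells apart
  need different encodings.\<close>

lemma inj_on_enc:
  assumes "data_structure X Q answer enc dec" "F \<subseteq> X"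
    and "\<And>x y. x \<in> F \<Longrightarrow> y \<in> F \<Longrightarrow> \<forall>q\<in>Q. answer x q = answer y q \<Longrightarrow> x = y"
  shows "inj_on enc F"
proof (rule inj_onI)
  fix x y assume xy: "x \<in> F" "y \<in> F" "enc x = enc y"
  then have "answer x q = answer y q" if "q \<in> Q" for q
    using assms(1,2) that unfolding data_structure_def by (metis subsetD)
  then show "x = y" using assms(3) xy by blast
qed

text \<open>Encodings may differ in length. There are \<open>2 ^ Suc L - 1\<close> bit strings of
  length at most \<open>L\<close>, hence the \<open>Suc\<close> in the exponent.\<close>

lemma card_less_worst_case_space:
  assumes "finite X" "F \<subseteq> X" "inj_on enc F"
  shows "card F < 2 ^ Suc (worst_case_space X enc)"
proof -
  let ?L = "worst_case_space X enc"
  let ?B = "{bs :: bool list. set bs \<subseteq> UNIV \<and> length bs \<le> ?L}"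
  have "enc ` F \<subseteq> ?B"
    using assms(1,2) unfolding worst_case_space_def by (auto intro!: Max_ge)
  then have "card F \<le> card ?B"
    using assms(3) by (intro card_inj_on_le finite_lists_length_le) auto
  also have "card ?B = (\<Sum>i\<le>?L. 2 ^ i)"
    by (subst card_lists_length_le) (auto simp: card_UNIV_bool)
  also have "(\<Sum>i\<le>l. 2 ^ i) < (2 :: nat) ^ Suc l" for l
    by (induction l) auto
  finally show ?thesis .
qed

lemma special_rank_append_Cons:
  "special_rank (A @ x # B) (Suc (length A)) = Suc (count_list A x)"
proof -
  let ?I = "{i. i < length A \<and> x = A ! i}"
  have "{i \<in> {1..Suc (length A)}. (A @ x # B) ! (i - 1) = x}
        = Suc ` {i \<in> {..length A}. (A @ x # B) ! i = x}"
    by (auto simp: Suc_le_eq gr0_conv_Suc)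
  also have "{i \<in> {..length A}. (A @ x # B) ! i = x} = insert (length A) ?I"
    by (auto simp: nth_append)
  finally have "special_rank (A @ x # B) (Suc (length A)) = card (Suc ` insert (length A) ?I)"
    by (simp add: special_rank_def)
  also have "\<dots> = card (insert (length A) ?I)" by (rule card_image) (rule inj_Suc)
  also have "\<dots> = Suc (card ?I)" by simp
  also have "card ?I = count_list A x"
    by (simp add: count_list_eq_length_filter length_filter_conv_card)
  finally show ?thesis .
qed

lemma count_list_distinct: "distinct xs \<Longrightarrow> x \<in> set xs \<Longrightarrow> count_list xs x = 1"
  by (induction xs) auto

text \<open>The entries of \<open>p\<close> before index \<open>i\<close> differ from
  \<open>p ! i\<close>, so only \<open>A\<close> and the queried position itself contribute to the
  rank.\<close>

lemma special_rank_permutation: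
  assumes cnt: "\<And>x. x < s \<Longrightarrow> count_list A x = x + k"
    and p: "p \<in> permutations_of_set {..<s}" and i: "i < s"
  shows "special_rank (A @ p @ B) (Suc (length A + i)) = Suc (p ! i + k)"
proof -
  have len: "length p = s" and dist: "distinct p"
    using p length_finite_permutations_of_set[OF p] permutations_of_setD(2)[OF p] by auto
  have "p ! i < s"
    using i len permutations_of_setD(1)[OF p] nth_mem[of i p] by auto
  moreover have "p ! i \<notin> set (take i p)"
    using dist i len by (auto simp: in_set_conv_nth nth_eq_iff_index_eq)
  ultimately have count: "count_list (A @ take i p) (p ! i) = p ! i + k"
    by (simp add: cnt)
  have split: "A @ p @ B = (A @ take i p) @ p ! i # (drop (Suc i) p @ B)"
    using id_take_nth_drop[of i p] i len by simp
  have "length (A @ take i p) = length A + i"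
    using i len by simp
  then show ?thesis
    using special_rank_append_Cons[of "A @ take i p" "p ! i" "drop (Suc i) p @ B"]
    unfolding split count by metis
qed

text \<open>The permutations are recovered from left to right: a recovered one joins the prefix
  \<open>A\<close>, whose offset \<open>k\<close> then grows by one. The common tail
  \<open>C\<close> lies behind all queried positions.\<close>

lemma special_rank_permutations_inject:
  assumes "\<And>x. x < s \<Longrightarrow> count_list A x = x + k"
    and "ps \<in> lists (permutations_of_set {..<s})" "qs \<in> lists (permutations_of_set {..<s})"
    and "length ps = length qs"
    and "\<forall>j\<in>{1..length A + length ps * s}.
           special_rank (A @ concat ps @ C) j = special_rank (A @ concat qs @ C) j"
  shows "ps = qs"
  using assms
proof (induction ps arbitrary: qs A k)
  case Nil
  then show ?case by simp
next
  case (Cons p ps)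
  then obtain q qs' where qs: "qs = q # qs'" by (cases qs) auto
  have p: "p \<in> permutations_of_set {..<s}" and q: "q \<in> permutations_of_set {..<s}"
    using Cons.prems qs by auto
  have lp: "length p = s" and lq: "length q = s"
    using length_finite_permutations_of_set[OF p] length_finite_permutations_of_set[OF q] by auto
  have "p ! i = q ! i" if i: "i < s" for i
    using bspec[OF Cons.prems(5), of "Suc (length A + i)"] i
      special_rank_permutation[OF Cons.prems(1) p i, of "concat ps @ C"]
      special_rank_permutation[OF Cons.prems(1) q i, of "concat qs' @ C"]
    by (simp add: qs)
  then have pq: "p = q" using lp lq by (intro nth_equalityI) auto
  \<comment> \<open>Each symbol below \<open>s\<close> occurs exactly once in
    \<open>p\<close>.\<close>
  have "count_list (A @ p) x = x + Suc k" if "x < s" for x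
    using Cons.prems(1)[OF that] p that
    by (simp add: permutations_of_set_def count_list_distinct)
  moreover have "\<forall>j\<in>{1..length (A @ p) + length ps * s}.
      special_rank ((A @ p) @ concat ps @ C) j = special_rank ((A @ p) @ concat qs' @ C) j"
    using Cons.prems(5) lp by (simp add: qs pq)
  ultimately have "ps = qs'"
    using Cons.prems qs by (intro Cons.IH[of "A @ p" "Suc k"]) auto
  then show ?case using qs pq by simp
qed

definition staircase :: "nat \<Rightarrow> nat list" where
  "staircase s = concat (map (\<lambda>i. replicate i i) [0..<s])"

lemma set_staircase: "set (staircase s) \<subseteq> {0..<s}"
  by (auto simp: staircase_def)

lemma staircase_Suc: "staircase (Suc s) = staircase s @ replicate s s"
  by (simp add: staircase_def)

text \<open>A triangular number, stated without subtraction or division to suit linear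
  arithmetic.\<close>

lemma length_staircase: "2 * length (staircase s) + s = s * s"
  by (induction s) (simp_all add: staircase_Suc, simp add: staircase_def)

lemma count_list_replicate: "count_list (replicate k y) x = (if x = y then k else 0)"
  by (induction k) auto

lemma count_list_staircase: "x < s \<Longrightarrow> count_list (staircase s) x = x"
proof (induction s)
  case (Suc s)
  have "s \<notin> set (staircase s)" using set_staircase[of s] by auto
  with Suc show ?case
    by (auto simp: staircase_Suc count_list_replicate less_Suc_eq)
qed simp

text \<open>Pairing the factor \<open>Suc i\<close> of one factorial with \<open>s - i\<close> of
  the other gives \<open>s\<close> products, each at least \<open>s\<close>. This elementary bound
  replaces Stirling's formula.\<close>

lemma power_self_le_fact_squared: "s ^ s \<le> (fact s :: nat) ^ 2"
proof -
  have "(\<Prod>i<s. s - i) = (\<Prod>i<s. Suc i)"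
    by (rule prod.reindex_bij_witness[of _ "\<lambda>i. s - Suc i" "\<lambda>i. s - Suc i"]) auto
  moreover have "fact s = (\<Prod>i<s. Suc i)"
    by (simp only: fact_prod_Suc lessThan_atLeast0 of_nat_id)
  ultimately have "(fact s :: nat) ^ 2 = (\<Prod>i<s. Suc i * (s - i))"
    by (simp only: prod.distrib power2_eq_square)
  moreover have "(\<Prod>i<s. s) \<le> (\<Prod>i<s. Suc i * (s - i))"
  proof (rule prod_mono)
    fix i assume "i \<in> {..<s}"
    then obtain d where "s = Suc (i + d)" by (auto simp: less_iff_Suc_add)
    \<comment> \<open>Here \<open>Suc i * (s - i) = Suc i * Suc d = s + i * d\<close>.\<close>
    then show "0 \<le> s \<and> s \<le> Suc i * (s - i)" by (simp add: algebra_simps)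
  qed
  ultimately show ?thesis by simp
qed

lemma fact_power_less_worst_case_space:
  assumes ds: "data_structure (strings \<sigma> n) {1..n} special_rank enc dec"
    and s: "0 < s" "s \<le> \<sigma>" and n: "length (staircase s) + m * s \<le> n"
  shows "(fact s :: nat) ^ m < 2 ^ Suc (worst_case_space (strings \<sigma> n) enc)"
proof -
  define P where "P = permutations_of_set {..<s}"
  \<comment> \<open>Padding to length \<open>n\<close>, the same for all strings of the
    family.\<close>
  define C where "C = replicate (n - (length (staircase s) + m * s)) (0::nat)"
  define D where "D = {ps. set ps \<subseteq> P \<and> length ps = m}"
  define T where "T ps = staircase s @ concat ps @ C" for ps
  have len: "length (concat ps) = length ps * s" if "set ps \<subseteq> P" for ps
    using that
    by (induction ps) (auto simp: P_def dest: length_finite_permutations_of_set)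
  have "set (concat ps) \<subseteq> {0..<\<sigma>}" if "set ps \<subseteq> P" for ps
    using that s by (fastforce simp: P_def permutations_of_set_def)
  then have TX: "T ` D \<subseteq> strings \<sigma> n"
    using n len s set_staircase[of s]
    by (fastforce simp: D_def T_def strings_def C_def)
  have inject: "ps = qs"
    if "ps \<in> D" "qs \<in> D" "\<forall>j\<in>{1..n}. special_rank (T ps) j = special_rank (T qs) j" for ps qs
    using that n
    by (intro special_rank_permutations_inject[of s "staircase s" 0 ps qs C])
       (auto simp: count_list_staircase D_def P_def T_def lists_eq_set)
  have "inj_on T D"
    using inject by (auto intro: inj_onI)
  moreover have "card D = fact s ^ m"
    unfolding D_def by (subst card_lists_length_eq) (auto simp: P_def card_permutations_of_set)
  ultimately have "card (T ` D) = fact s ^ m"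
    by (simp add: card_image)
  moreover have "inj_on enc (T ` D)"
    using inject by (intro inj_on_enc[OF ds TX]) blast
  ultimately show ?thesis
    using card_less_worst_case_space[OF finite_strings TX] by metis
qed

text \<open>Two strings that differ only at position 2 have different ranks there, so not both
  encodings are empty. This later absorbs the additive one of \<open>Suc L\<close>.\<close>

lemma worst_case_space_pos:
  assumes ds: "data_structure (strings \<sigma> n) {1..n} special_rank enc dec"
    and "2 \<le> \<sigma>" "2 \<le> n"
  shows "0 < worst_case_space (strings \<sigma> n) enc"
proof -
  define R where "R = replicate (n - 2) (0::nat)"
  define F where "F = {0 # 0 # R, 0 # 1 # R}"
  have F: "F \<subseteq> strings \<sigma> n"
    using assms(2,3) by (auto simp: F_def R_def strings_def)
  have "special_rank (0 # x # R) 2 = Suc (count_list [0] x)" for x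
    using special_rank_append_Cons[of "[0]" x R] by (simp add: numeral_2_eq_2)
  then have "special_rank (0 # 0 # R) 2 \<noteq> special_rank (0 # 1 # R) 2" by simp
  moreover have "2 \<in> {1..n}" using assms(3) by simp
  ultimately have "inj_on enc F"
    by (intro inj_on_enc[OF ds F]) (auto simp: F_def)
  then have "card F < 2 ^ Suc (worst_case_space (strings \<sigma> n) enc)"
    by (rule card_less_worst_case_space[OF finite_strings F])
  moreover have "card F = 2" by (simp add: F_def)
  ultimately show ?thesis by (cases "worst_case_space (strings \<sigma> n) enc") auto
qed

text \<open>The constant 16 is the product of 4 from \<open>n \<le> 4 * (m * s)\<close>, 2 from
  squaring the factorial, and 2 from \<open>Suc L \<le> 2 * L\<close>.\<close>

lemma worst_case_space_ge:
  assumes ds: "data_structure (strings \<sigma> n) {1..n} special_rank enc dec"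
    and s: "2 \<le> s" "s \<le> \<sigma>" "s * s \<le> n"
  shows "real n * log 2 (real s) \<le> 16 * real (worst_case_space (strings \<sigma> n) enc)"
proof -
  define L where "L = worst_case_space (strings \<sigma> n) enc"
  \<comment> \<open>The number of whole permutations that fit behind the staircase.\<close>
  define m where "m = (n - length (staircase s)) div s"
  have st: "2 * length (staircase s) + s = s * s" by (rule length_staircase)
  have ms: "m * s \<le> n - length (staircase s)"
    unfolding m_def by (rule div_times_less_eq_dividend)
  have "n - length (staircase s) < m * s + s"
    using dividend_less_div_times[of s "n - length (staircase s)"] s by (simp add: m_def)
  moreover have "2 * s \<le> s * s" using s(1) by (rule mult_le_mono1)
  \<comment> \<open>The staircase takes at most \<open>(n - s) / 2\<close> positions and rounding
    loses fewer than \<open>s\<close>, so \<open>n < 2 * (m * s) + s\<close>. Moreover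
    \<open>2 * s \<le> s * s \<le> n\<close>.\<close>
  ultimately have nms: "n \<le> 4 * (m * s)" using st s by linarith
  have "(fact s :: nat) ^ m < 2 ^ Suc L"
    using s ms st unfolding L_def by (intro fact_power_less_worst_case_space[OF ds]) linarith+
  then have "((fact s :: nat) ^ m) ^ 2 < (2 ^ Suc L) ^ 2"
    by (rule power_strict_mono) auto
  moreover have "(s ^ s) ^ m \<le> ((fact s :: nat) ^ 2) ^ m"
    by (intro power_mono power_self_le_fact_squared) simp
  ultimately have "s ^ (m * s) < 2 ^ (2 * Suc L)"
    by (simp add: power_mult[symmetric] mult.commute del: power_Suc)
  then have "real s ^ (m * s) < 2 ^ (2 * Suc L)"
    by (metis of_nat_less_iff of_nat_numeral of_nat_power)
  then have "log 2 (real s ^ (m * s)) \<le> log 2 (2 ^ (2 * Suc L))"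
    using s by (intro log_mono) auto
  then have "real (m * s) * log 2 (real s) \<le> 2 * real (Suc L)"
    using s by (simp add: log_nat_power del: power_Suc)
  moreover have "real n * log 2 (real s) \<le> (4 * real (m * s)) * log 2 (real s)"
    using nms s by (intro mult_right_mono) (simp_all flip: of_nat_mult)
  moreover have "1 \<le> real L"
    using worst_case_space_pos[OF ds] s st mult_le_mono[OF s(1) s(1)] unfolding L_def by simp
  ultimately show ?thesis unfolding L_def[symmetric] by simp
qed

lemma worst_case_space_ge_sigma:
  assumes ds: "data_structure (strings \<sigma> n) {1..n} special_rank enc dec"
    and \<sigma>: "2 \<le> \<sigma>" "\<sigma> \<le> n"
  shows "real n * log 2 (real \<sigma>) \<le> 64 * real (worst_case_space (strings \<sigma> n) enc)"
proof (cases "4 \<le> n")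
  case True
  \<comment> \<open>The maximum with 2 matters for \<sigma> below 4, where the root is 1; then
    \<open>s * s \<le> n\<close> holds by \<open>4 \<le> n\<close>.\<close>
  define s where "s = max 2 (floor_sqrt \<sigma>)"
  have "floor_sqrt \<sigma> ^ 2 \<le> \<sigma>" "\<sigma> < Suc (floor_sqrt \<sigma>) ^ 2"
    by (simp_all add: Suc_floor_sqrt_power2_gt)
  then have s: "2 \<le> s" "s \<le> \<sigma>" "s * s \<le> n" "\<sigma> < Suc s ^ 2"
    using True \<sigma> floor_sqrt_le[of \<sigma>] power_mono[of "Suc (floor_sqrt \<sigma>)" "Suc s" 2]
    by (auto simp: s_def max_def power2_eq_square)
  have "Suc s \<le> s ^ 2"
    using s(1) mult_le_mono1[of 2 s s] unfolding power2_eq_square by linarith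
  then have "Suc s ^ 2 \<le> (s ^ 2) ^ 2" by (rule power_mono) simp
  \<comment> \<open>Passing from \<open>s\<close> to \<sigma> thus costs a factor 4, which turns 16
    into 64.\<close>
  then have "\<sigma> \<le> s ^ 4" using s(4) by simp
  then have "log 2 (real \<sigma>) \<le> log 2 (real s ^ 4)"
    using \<sigma> s by (intro log_mono) (simp_all flip: of_nat_power)
  also have "\<dots> = 4 * log 2 (real s)" using s by (simp add: log_nat_power)
  finally have "real n * log 2 (real \<sigma>) \<le> real n * (4 * log 2 (real s))"
    by (intro mult_left_mono) auto
  then show ?thesis using worst_case_space_ge[OF ds s(1-3)] by simp
next
  case False
  \<comment> \<open>No \<open>s \<ge> 2\<close> has \<open>s * s \<le> n\<close> here, but the
    left-hand side is at most 8, so a single bit of space suffices.\<close>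
  have "log 2 (real \<sigma>) \<le> log 2 (2 ^ 2)" using \<sigma> False by (intro log_mono) auto
  then have "log 2 (real \<sigma>) \<le> 2" by (simp only: log_nat_power) simp
  then have "real n * log 2 (real \<sigma>) \<le> 4 * 2"
    using False \<sigma> by (intro mult_mono) auto
  moreover have "1 \<le> real (worst_case_space (strings \<sigma> n) enc)"
    using worst_case_space_pos[OF ds] \<sigma> by simp
  ultimately show ?thesis by simp
qed

theorem theorem2p1:
  shows "\<exists>\<delta>::real. \<delta> > 0 \<and>
    (\<forall>(\<sigma>::nat) (n::nat) (enc :: nat list \<Rightarrow> bool list) (dec :: bool list \<Rightarrow> nat \<Rightarrow> nat).
      2 \<le> \<sigma> \<and> \<sigma> \<le> n \<and> data_structure (strings \<sigma> n) {1..n} special_rank enc dec \<longrightarrow>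
      \<delta> * real n * log 2 (real \<sigma>) \<le> real (worst_case_space (strings \<sigma> n) enc))"
proof (intro exI[of _ "1 / 64"] conjI allI impI)
  fix \<sigma> n :: nat and enc :: "nat list \<Rightarrow> bool list" and dec
  assume "2 \<le> \<sigma> \<and> \<sigma> \<le> n \<and> data_structure (strings \<sigma> n) {1..n} special_rank enc dec"
  then show "1 / 64 * real n * log 2 (real \<sigma>) \<le> real (worst_case_space (strings \<sigma> n) enc)"
    using worst_case_space_ge_sigma[of \<sigma> n enc dec] by linarith
qed simp

end
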